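(* Let $x,v\in\mathbb{R}$ and set $E:=(1+v^2)^2+16x^2$, $R:=\sqrt{E}$, $P:=\sqrt{R+1+v^2}$ and $Q:=\sqrt{R-1-v^2}$. Then $$\begin{aligned}\frac{\pi^2}{2}\,p_{1/2}\Big(1,x+\frac v2,v\Big)=\;&\frac{2}{E}+\frac{4|x|\,P+(1+v^2)\,Q}{4\sqrt2\,R^3}\,\ln\left(1-\frac{4\sqrt2\,|x|}{2\sqrt2\,|x|+\dfrac{4x^2+R}{P}}\right)\\&+\frac{(1+v^2)\,P-4|x|\,Q}{2\sqrt2\,R^3}\left[\arctan\frac{\sqrt2-Q}{P+\sqrt2\,|v|}+\arctan\frac{\sqrt2+Q}{P+\sqrt2\,|v|}+\arctan\frac{\sqrt2+Q}{P-\sqrt2\,|v|}+\arctan\frac{\sqrt2-Q}{P-\sqrt2\,|v|}\right].\end{aligned}$$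
   Context: Here $p_{1/2}$ is the fundamental solution of the fractional Kolmogorov equation $\partial_t u+v\,\partial_x u+(-\Delta_v)^{1/2}u=0$ in $(0,\infty)\times\mathbb{R}\times\mathbb{R}$ (with $(-\Delta_v)^{1/2}$ having Fourier symbol $|\phi|$), i.e. $$p_{1/2}(t,x,v)=\frac{1}{(2\pi)^2}\int_{\mathbb{R}}\int_{\mathbb{R}}e^{i(x\xi+v\phi)}\exp\Big(-\int_0^t|\phi+u\xi|\,du\Big)\,d\xi\,d\phi .$$ *)

theory Defs
  imports "HOL-Analysis.Analysis"
begin

text \<open>
  The fundamental solution of the fractional Kolmogorov equation
  \<open>\<partial>\<^sub>t u + v \<partial>\<^sub>x u + (-\<Delta>\<^sub>v)\<^bsup>1/2\<^esup> u = 0\<close> on \<open>(0,\<infinity>) \<times> \<real> \<times> \<real>\<close>, given by its Fourier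
  representation; only the values at \<open>t > 0\<close> are meaningful. The function is real-valued, but
  the Fourier integral makes it a complex number.
\<close>

definition p_half :: "real \<Rightarrow> real \<Rightarrow> real \<Rightarrow> complex" where
  "p_half t x v =
     1 / (2 * of_real pi)\<^sup>2 *
     (LINT \<phi>|lborel. (LINT \<xi>|lborel.
        exp (\<i> * of_real (x * \<xi> + v * \<phi>)) *
        of_real (exp (- (LINT u:{0..t}|lborel. \<bar>\<phi> + u * \<xi>\<bar>)))))"

end

theory Submission
  imports Defs "HOL-Probability.Sinc_Integral"
begin

text \<open>
  Along a ray \<open>\<xi> = \<phi> t\<close> of fixed slope the exponent is homogeneous:
  \<open>\<integral>\<^sub>0\<^sup>1 \<bar>\<phi> + u \<phi> t\<bar> du = \<bar>\<phi>\<bar> k(t)\<close> with \<open>k(t) = \<integral>\<^sub>0\<^sup>1 \<bar>1 + u t\<bar> du\<close>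
  (\<open>abs_mean\<close>). In the coordinates \<open>(\<phi>, t)\<close> the oscillating phase is \<open>\<phi> q(t)\<close>, where
  \<open>q(t) = X t + v\<close> and \<open>X = x + v/2\<close>, and the Jacobian is \<open>\<bar>\<phi>\<bar>\<close>. After exchanging the order
  of integration the \<open>\<phi>\<close>-integral is an elementary Laplace transform, so that the double integral
  becomes \<open>2 Re \<integral> dt / (k(t) - \<i> q(t))\<^sup>2\<close> (\<open>p_half_slope_integral\<close>). The exchange is legitimate
  because the absolute integral in \<open>\<phi>\<close> is \<open>2 / k(t)\<^sup>2\<close>, and \<open>k\<close> grows linearly.

  For \<open>t \<ge> -1\<close> the function \<open>1 + u t\<close> does not change sign, \<open>k\<close> is affine, and that part of the
  integral is rational. For \<open>t < -1\<close> the substitution \<open>y = 1 + 2/t\<close> turns the integral into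
  \<open>8 \<integral> dy / (z\<^sup>2 + c\<^sup>2)\<^sup>2\<close> over \<open>-1 < y < 1\<close>, with \<open>z = y + \<i> v\<close> and \<open>c\<^sup>2 = 1 + v\<^sup>2 + 4 \<i> x\<close>.
  A primitive is
  \<open>z / (2 c\<^sup>2 (z\<^sup>2 + c\<^sup>2)) + (1 / (4 c\<^sup>3)) \<integral> (1 / (c + \<i> z) + 1 / (c - \<i> z)) dy\<close>,
  and the last integral has real part a sum of arctangents and imaginary part a sum of logarithms
  (\<open>square_primitive_derivative\<close>).

  The quantities \<open>P\<close> and \<open>Q\<close> of the theorem encode the square root:
  \<open>c = (P + \<i> Q) / sqrt 2\<close> for \<open>x \<ge> 0\<close> and its conjugate for \<open>x < 0\<close>, and \<open>\<bar>c\<bar>\<^sup>2 = R\<close>.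
  Taking real parts at \<open>y = 1\<close> and \<open>y = -1\<close> gives the formula: the rational contributions of both
  ranges of \<open>t\<close> add up to \<open>2 / E\<close> (\<open>rational_part\<close>), the arctangents are exactly the four of the
  theorem, and the four logarithms combine into one because the product of their arguments
  simplifies (\<open>square_primitive_increment\<close>). The expression obtained is even in \<open>v\<close> and in \<open>x\<close>,
  which accounts for the absolute values.
\<close>

section \<open>The Laplace transform of the identity\<close>

lemma set_integrable_mult_exp_half_line:
  fixes k :: real assumes "k > 0"
  shows "set_integrable lborel {0<..} (\<lambda>s. s * exp (- (k * s)))"
proof -
  let ?F = "\<lambda>s. - (s / k + 1 / k\<^sup>2) * exp (- (k * s))"
  have B: "((?F \<circ> real_of_ereal) \<longlongrightarrow> 0) (at_left \<infinity>)"
    unfolding ereal_tendsto_simps using assms by real_asymp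
  have A: "((?F \<circ> real_of_ereal) \<longlongrightarrow> - 1 / k\<^sup>2) (at_right 0)"
    unfolding zero_ereal_def ereal_tendsto_simps using assms
    by (auto intro!: tendsto_eq_intros)
  have D: "DERIV ?F s :> s * exp (- (k * s))" for s
    by (rule derivative_eq_intros refl | use assms in \<open>simp add: field_simps power2_eq_square\<close>)+
  have C: "isCont (\<lambda>s. s * exp (- (k * s))) s" for s
    by (intro continuous_intros)
  have N: "AE s in lborel. 0 < ereal s \<longrightarrow> ereal s < \<infinity> \<longrightarrow> 0 \<le> s * exp (- (k * s))"
    by (rule AE_I2) (simp add: zero_ereal_def)
  have "set_integrable lborel (einterval 0 \<infinity>) (\<lambda>s. s * exp (- (k * s)))"
    by (rule interval_integral_FTC_nonneg[OF _ D C N A B]) simp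
  then show ?thesis by (simp add: zero_ereal_def)
qed

text \<open>
  The primitive \<open>-(s/z + 1/z\<^sup>2) exp (-z s)\<close> vanishes at infinity; integrability comes from the real
  case, since the modulus of the integrand only depends on \<open>Re z\<close>.
\<close>

lemma laplace_transform_identity:
  fixes z :: complex assumes "Re z > 0"
  shows "set_integrable lborel {0<..} (\<lambda>s. of_real s * exp (- (z * of_real s)))"
    and "(LINT s:{0<..}|lborel. of_real s * exp (- (z * of_real s))) = 1 / z\<^sup>2"
proof -
  let ?f = "\<lambda>s::real. of_real s * exp (- (z * of_real s))"
  let ?F = "\<lambda>s::real. - (of_real s / z + 1 / z\<^sup>2) * exp (- (z * of_real s))"
  have z: "z \<noteq> 0" using assms by auto
  show I: "set_integrable lborel {0<..} ?f"
    by (rule set_integrable_bound[OF set_integrable_mult_exp_half_line[OF assms]])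
       (auto simp: set_borel_measurable_def norm_mult)
  have B: "((?F \<circ> real_of_ereal) \<longlongrightarrow> 0) (at_left \<infinity>)"
    unfolding ereal_tendsto_simps
  proof (rule Lim_null_comparison)
    show "\<forall>\<^sub>F s in at_top. norm (?F s) \<le> (s / norm z + 1 / (norm z)\<^sup>2) * exp (- (Re z * s))"
      using eventually_ge_at_top[of 0]
    proof eventually_elim
      case (elim s)
      have "norm (of_real s / z + 1 / z\<^sup>2) \<le> s / norm z + 1 / (norm z)\<^sup>2"
        by (rule order_trans[OF norm_triangle_ineq]) (use elim in \<open>simp add: norm_divide norm_power\<close>)
      then show ?case unfolding norm_mult norm_minus_cancel
        by (simp add: mult_right_mono)
    qed
    have n: "norm z > 0" using z by simp
    show "((\<lambda>s. (s / norm z + 1 / (norm z)\<^sup>2) * exp (- (Re z * s))) \<longlongrightarrow> 0) at_top"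
      using assms n by real_asymp
  qed
  have A: "((?F \<circ> real_of_ereal) \<longlongrightarrow> ?F 0) (at_right 0)"
    unfolding zero_ereal_def ereal_tendsto_simps using z
    by (intro tendsto_intros) auto
  have D: "(?F has_vector_derivative ?f s) (at s)" for s
    by (rule has_vector_derivative_real_field)
       (rule derivative_eq_intros refl | use z in \<open>simp add: field_simps power2_eq_square\<close>)+
  have C: "isCont ?f s" for s
    by (intro continuous_intros)
  have "(LBINT s=0..\<infinity>. ?f s) = 0 - ?F 0"
    by (rule interval_integral_FTC_integrable[OF _ D C _ A B])
       (use I in \<open>simp_all add: zero_ereal_def\<close>)
  then show "(LINT s:{0<..}|lborel. ?f s) = 1 / z\<^sup>2"
    by (simp add: interval_lebesgue_integral_0_infty)
qed

lemma line_integral_split_at_0: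
  fixes f :: "real \<Rightarrow> 'a::{banach, second_countable_topology}"
  assumes "set_integrable lborel {0<..} f" "set_integrable lborel {0<..} (\<lambda>s. f (- s))" "f 0 = 0"
  shows "integrable lborel f"
    and "(LINT s|lborel. f s) = (LINT s:{0<..}|lborel. f s) + (LINT s:{0<..}|lborel. f (- s))"
proof -
  define g where "g s = indicator {0<..} s *\<^sub>R f s" for s :: real
  define h where "h s = indicator {0<..} s *\<^sub>R f (- s)" for s :: real
  have f: "f = (\<lambda>s. g s + h (0 + (- 1) * s))"
    using assms(3) by (auto simp: g_def h_def fun_eq_iff indicator_def)
  have g: "integrable lborel g" and h: "integrable lborel h"
    using assms(1,2) unfolding set_integrable_def g_def h_def by auto
  have h': "integrable lborel (\<lambda>s. h (0 + (- 1) * s))"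
    by (rule lborel_integrable_real_affine[OF h]) simp
  show "integrable lborel f"
    unfolding f using g h' by (rule Bochner_Integration.integrable_add)
  have "(LINT s|lborel. f s) = integral\<^sup>L lborel g + (LINT s|lborel. h (0 + (- 1) * s))"
    unfolding f using g h' by (rule Bochner_Integration.integral_add)
  also have "(LINT s|lborel. h (0 + (- 1) * s)) = integral\<^sup>L lborel h"
    using lborel_integral_real_affine[of "-1" h 0] by simp
  finally show "(LINT s|lborel. f s) = (LINT s:{0<..}|lborel. f s) + (LINT s:{0<..}|lborel. f (- s))"
    unfolding set_lebesgue_integral_def g_def h_def .
qed

text \<open>
  On each half line the phase and the damping merge into a single exponential, with the complex rates
  \<open>k - \<i> q\<close> and \<open>k + \<i> q\<close>.
\<close>

lemma two_sided_laplace_transform_abs: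
  fixes k q :: real assumes "k > 0"
  defines "f \<equiv> \<lambda>s::real. of_real \<bar>s\<bar> * exp (\<i> * of_real (s * q)) * of_real (exp (- (\<bar>s\<bar> * k)))"
  shows "integrable lborel f"
    and "(LINT s|lborel. f s) = 1 / (of_real k - \<i> * of_real q)\<^sup>2 + 1 / (of_real k + \<i> * of_real q)\<^sup>2"
proof -
  let ?g = "\<lambda>z s::real. of_real s * exp (- (z * of_real s)) :: complex"
  have p: "f s = ?g (of_real k - \<i> * of_real q) s" and m: "f (- s) = ?g (of_real k + \<i> * of_real q) s"
    if "s > 0" for s
    unfolding f_def exp_of_real[symmetric] using that
    by (simp_all add: mult.assoc exp_add[symmetric] algebra_simps)
  have z: "Re (of_real k - \<i> * of_real q) > 0" "Re (of_real k + \<i> * of_real q) > 0"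
    using assms by auto
  have i1: "set_integrable lborel {0<..} f"
    by (rule iffD2[OF set_integrable_cong laplace_transform_identity(1)[OF z(1)]]) (use p in auto)
  have i2: "set_integrable lborel {0<..} (\<lambda>s. f (- s))"
    by (rule iffD2[OF set_integrable_cong laplace_transform_identity(1)[OF z(2)]]) (use m in auto)
  have f0: "f 0 = 0" by (simp add: f_def)
  show "integrable lborel f"
    by (rule line_integral_split_at_0(1)[OF i1 i2 f0])
  have "(LINT s:{0<..}|lborel. f s) = (LINT s:{0<..}|lborel. ?g (of_real k - \<i> * of_real q) s)"
    by (rule set_lebesgue_integral_cong) (use p in auto)
  moreover have "(LINT s:{0<..}|lborel. f (- s)) = (LINT s:{0<..}|lborel. ?g (of_real k + \<i> * of_real q) s)"
    by (rule set_lebesgue_integral_cong) (use m in auto)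
  ultimately show "(LINT s|lborel. f s) = 1 / (of_real k - \<i> * of_real q)\<^sup>2 + 1 / (of_real k + \<i> * of_real q)\<^sup>2"
    unfolding line_integral_split_at_0(2)[OF i1 i2 f0] laplace_transform_identity(2)[OF z(1)] laplace_transform_identity(2)[OF z(2)]
    by simp
qed

section \<open>The mean modulus along a ray of fixed slope\<close>

definition abs_mean :: "real \<Rightarrow> real" where
  "abs_mean t = (LINT u:{0..1}|lborel. \<bar>1 + u * t\<bar>)"

lemma abs_mean_homogeneous:
  "(LINT u:{0..1}|lborel. \<bar>\<phi> + u * (\<phi> * t)\<bar>) = \<bar>\<phi>\<bar> * abs_mean t"
proof -
  have "\<bar>\<phi> + u * (\<phi> * t)\<bar> = \<bar>\<phi>\<bar> * \<bar>1 + u * t\<bar>" for u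
    by (simp add: abs_mult[symmetric] algebra_simps)
  then show ?thesis by (simp add: abs_mean_def)
qed

lemma abs_mean_right:
  assumes "t \<ge> - 1" shows "abs_mean t = 1 + t / 2"
proof -
  have pos: "1 + u * t \<ge> 0" if "0 \<le> u" "u \<le> 1" for u
  proof -
    have "u * t \<ge> u * (-1)" using assms that by (intro mult_left_mono) auto
    with that show ?thesis by linarith
  qed
  have "abs_mean t = (LINT u:{0..1}|lborel. 1 + u * t)"
    unfolding abs_mean_def by (rule set_lebesgue_integral_cong) (use pos in auto)
  also have "\<dots> = (LBINT u=ereal 0..ereal 1. 1 + u * t)"
    by (rule interval_integral_Icc[symmetric]) simp
  also have "\<dots> = (1 + 1\<^sup>2 * t / 2) - (0 + 0\<^sup>2 * t / 2)"
  proof (rule interval_integral_FTC_finite)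
    show "continuous_on {min 0 1..max 0 1} (\<lambda>u. 1 + u * t)" by (intro continuous_intros)
    show "((\<lambda>u. u + u\<^sup>2 * t / 2) has_vector_derivative 1 + u * t) (at u within {min 0 1..max 0 1})" for u
      unfolding has_real_derivative_iff_has_vector_derivative[symmetric]
      by (rule derivative_eq_intros refl | simp)+
  qed
  finally show ?thesis by simp
qed

lemma DERIV_mult_abs: "((\<lambda>w::real. w * \<bar>w\<bar>) has_real_derivative 2 * \<bar>w\<bar>) (at w)"
proof (cases "w = 0")
  case True
  have "(\<lambda>h::real. \<bar>h\<bar>) \<midarrow>0\<rightarrow> \<bar>0\<bar>" by (intro tendsto_intros)
  then have "(\<lambda>h::real. ((0 + h) * \<bar>0 + h\<bar> - 0 * \<bar>0\<bar>) / h) \<midarrow>0\<rightarrow> \<bar>0\<bar>"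
    by (rule Lim_transform_eventually) (auto simp: eventually_at_filter)
  then show ?thesis using True by (simp add: DERIV_def)
next
  case False
  have "((\<lambda>u. sgn w * u\<^sup>2) has_real_derivative 2 * \<bar>w\<bar>) (at w)"
    by (rule derivative_eq_intros refl | simp add: abs_sgn)+
  then show ?thesis
  proof (rule has_field_derivative_transform_within_open)
    show "open (if w > 0 then {0<..} else {..<0::real})" by simp
    show "w \<in> (if w > 0 then {0<..} else {..<0})" using False by simp
    show "sgn w * u\<^sup>2 = u * \<bar>u\<bar>" if "u \<in> (if w > 0 then {0<..} else {..<0})" for u
      using that False by (auto simp: power2_eq_square split: if_splits)
  qed
qed

text \<open>
  The primitive \<open>(1 + u t) \<bar>1 + u t\<bar> / (2 t)\<close> is differentiable also at the zero of \<open>1 + u t\<close>, so the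
  interval need not be split there.
\<close>

lemma abs_mean_left:
  assumes "t < - 1" shows "abs_mean t = (1 + (1 + t)\<^sup>2) / (- 2 * t)"
proof -
  let ?F = "\<lambda>u. (1 + u * t) * \<bar>1 + u * t\<bar> / (2 * t)"
  have "abs_mean t = (LBINT u=ereal 0..ereal 1. \<bar>1 + u * t\<bar>)"
    unfolding abs_mean_def by (rule interval_integral_Icc[symmetric]) simp
  also have "\<dots> = ?F 1 - ?F 0"
  proof (rule interval_integral_FTC_finite)
    show "continuous_on {min 0 1..max 0 1} (\<lambda>u. \<bar>1 + u * t\<bar>)" by (intro continuous_intros)
    fix u :: real
    have "((\<lambda>u. 1 + u * t) has_real_derivative t) (at u)"
      by (rule derivative_eq_intros refl | simp)+
    from DERIV_chain2[OF DERIV_mult_abs this]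
    have "(?F has_real_derivative 2 * \<bar>1 + u * t\<bar> * t / (2 * t)) (at u)"
      by (rule DERIV_cdivide)
    then show "(?F has_vector_derivative \<bar>1 + u * t\<bar>) (at u within {min 0 1..max 0 1})"
      unfolding has_real_derivative_iff_has_vector_derivative[symmetric]
      using assms by (simp add: has_field_derivative_at_within)
  qed
  also have "\<dots> = (1 + (1 + t)\<^sup>2) / (- 2 * t)"
    using assms by (simp add: field_simps power2_eq_square)
  finally show ?thesis .
qed

text \<open>
  Linear growth makes \<open>1/k\<^sup>2\<close> integrable, and positivity makes the Laplace transforms in \<open>\<phi>\<close>
  converge.
\<close>

lemma abs_mean_lower: "abs_mean t \<ge> (1 + \<bar>t\<bar>) / 8"
proof (cases "t \<ge> -1")
  case True
  then show ?thesis by (auto simp: abs_mean_right)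
next
  case False
  have "(1 + (1 + t)\<^sup>2) / (- 2 * t) \<ge> (1 + \<bar>t\<bar>) / 8"
  proof -
    \<comment> \<open>The difference of the two sides is \<open>3 t\<^sup>2 + 9 t + 8 = (3 (2 t + 3)\<^sup>2 + 5) / 4\<close>.\<close>
    have "(1 - t) * (- t) \<le> 4 * (1 + (1 + t)\<^sup>2)"
      using False zero_le_power2[of "2 * t + 3"] by (simp add: power2_eq_square algebra_simps)
    then show ?thesis using False by (simp add: field_simps)
  qed
  then show ?thesis using False by (simp add: abs_mean_left)
qed

lemma abs_mean_pos: "abs_mean t > 0"
  using abs_mean_lower[of t] by auto

lemma abs_mean_measurable [measurable]: "abs_mean \<in> borel_measurable borel"
proof -
  have *: "abs_mean = (\<lambda>t. if t \<ge> - 1 then 1 + t / 2 else (1 + (1 + t)\<^sup>2) / (- 2 * t))"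
    by (auto simp: fun_eq_iff abs_mean_right abs_mean_left)
  show ?thesis by (subst *) measurable
qed

lemma integrable_inverse_abs_mean_square: "integrable lborel (\<lambda>t. 1 / (abs_mean t)\<^sup>2)"
proof (rule Bochner_Integration.integrable_bound)
  show "integrable lborel (\<lambda>t::real. 64 * inverse (1 + t\<^sup>2))"
    using integrable_inverse_1_plus_square by (simp add: set_integrable_def)
  show "AE t in lborel. norm (1 / (abs_mean t)\<^sup>2) \<le> norm (64 * inverse (1 + t\<^sup>2))"
  proof (rule AE_I2)
    fix t :: real
    have "((1 + \<bar>t\<bar>) / 8)\<^sup>2 \<le> (abs_mean t)\<^sup>2"
      by (intro power_mono abs_mean_lower) simp
    moreover have "(1 + t\<^sup>2) / 64 \<le> ((1 + \<bar>t\<bar>) / 8)\<^sup>2"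
      by (simp add: power2_eq_square field_simps)
    ultimately have "(1 + t\<^sup>2) / 64 \<le> (abs_mean t)\<^sup>2" by linarith
    moreover have "1 + t\<^sup>2 > 0" by (simp add: add_pos_nonneg)
    ultimately show "norm (1 / (abs_mean t)\<^sup>2) \<le> norm (64 * inverse (1 + t\<^sup>2))"
      using abs_mean_pos[of t] by (simp add: field_simps)
  qed
qed simp

section \<open>Reduction to an integral over the slope\<close>

text \<open>
  The change of variable \<open>\<xi> = \<phi> t\<close> is made in the inner integral, with \<open>\<phi>\<close> fixed and nonzero, so a
  one-dimensional affine substitution suffices. Only then is Fubini's theorem used; its integrability
  hypothesis is checked by integrating the modulus over \<open>\<phi>\<close> first, which is the case of zero phase of
  the same Laplace transform.
\<close>

lemma p_half_slope_integral:
  "p_half 1 X v = 1 / (2 * of_real pi)\<^sup>2 *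
     (LINT t|lborel. 1 / (of_real (abs_mean t) - \<i> * of_real (X * t + v))\<^sup>2
                   + 1 / (of_real (abs_mean t) + \<i> * of_real (X * t + v))\<^sup>2)"
proof -
  define H where "H t \<phi> = of_real \<bar>\<phi>\<bar> * exp (\<i> * of_real (\<phi> * (X * t + v))) *
    of_real (exp (- (\<bar>\<phi>\<bar> * abs_mean t)))" for t \<phi> :: real
  define g where "g \<phi> = (LINT \<xi>|lborel. exp (\<i> * of_real (X * \<xi> + v * \<phi>)) *
    of_real (exp (- (LINT u:{0..1}|lborel. \<bar>\<phi> + u * \<xi>\<bar>))))" for \<phi> :: real
  have meas: "case_prod H \<in> borel_measurable (lborel \<Otimes>\<^sub>M lborel)"
    unfolding H_def by measurable
  have norm_H: "norm (H t \<phi>) = \<bar>\<phi>\<bar> * exp (- (\<bar>\<phi>\<bar> * abs_mean t))" for t \<phi>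
    by (simp add: H_def norm_mult)
  have norm_integral: "(LINT \<phi>|lborel. norm (H t \<phi>)) = 2 * (1 / (abs_mean t)\<^sup>2)" for t
  proof -
    have "complex_of_real (LINT \<phi>|lborel. norm (H t \<phi>)) = (LINT \<phi>|lborel. complex_of_real (norm (H t \<phi>)))"
      by simp
    also have "\<dots> = (LINT \<phi>|lborel. of_real \<bar>\<phi>\<bar> * exp (\<i> * of_real (\<phi> * 0)) *
        of_real (exp (- (\<bar>\<phi>\<bar> * abs_mean t))))"
      unfolding norm_H by simp
    also have "\<dots> = complex_of_real (2 * (1 / (abs_mean t)\<^sup>2))"
      unfolding two_sided_laplace_transform_abs(2)[OF abs_mean_pos] by simp
    finally show ?thesis unfolding of_real_eq_iff .
  qed
  have int_H: "integrable (lborel \<Otimes>\<^sub>M lborel) (case_prod H)"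
  proof (rule lborel_pair.Fubini_integrable[OF meas])
    show "integrable lborel (\<lambda>t. LINT \<phi>|lborel. norm (case_prod H (t, \<phi>)))"
      unfolding prod.case norm_integral
      by (rule integrable_mult_right[OF integrable_inverse_abs_mean_square])
    show "AE t in lborel. integrable lborel (\<lambda>\<phi>. case_prod H (t, \<phi>))"
      unfolding prod.case H_def
      by (rule AE_I2) (rule two_sided_laplace_transform_abs(1)[OF abs_mean_pos])
  qed
  have scale: "g \<phi> = (LINT t|lborel. H t \<phi>)" if "\<phi> \<noteq> 0" for \<phi>
  proof -
    have "g \<phi> = \<bar>\<phi>\<bar> *\<^sub>R (LINT t|lborel. exp (\<i> * of_real (X * (0 + \<phi> * t) + v * \<phi>)) *
      of_real (exp (- (LINT u:{0..1}|lborel. \<bar>\<phi> + u * (0 + \<phi> * t)\<bar>))))"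
      unfolding g_def by (rule lborel_integral_real_affine[OF that])
    also have "\<dots> = (LINT t|lborel. H t \<phi>)"
      unfolding add_0 abs_mean_homogeneous H_def scaleR_conv_of_real mult.assoc
        integral_mult_right_zero[symmetric]
      by (simp add: algebra_simps)
    finally show ?thesis .
  qed
  have mH [measurable]: "(\<lambda>\<phi>. LINT t|lborel. H t \<phi>) \<in> borel_measurable lborel"
    by (rule borel_measurable_integrable[OF lborel_pair.integrable_snd[OF int_H]])
  \<comment> \<open>Measurability of the inner integral, from that of its substituted form away from \<open>\<phi> = 0\<close>.\<close>
  have g_eq: "g = (\<lambda>\<phi>. if \<phi> = 0 then g 0 else LINT t|lborel. H t \<phi>)"
    using scale by auto
  have mg: "g \<in> borel_measurable lborel"
    by (subst g_eq) measurable
  have "(LINT \<phi>|lborel. g \<phi>) = (LINT \<phi>|lborel. (LINT t|lborel. H t \<phi>))"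
    by (rule integral_cong_AE[OF mg mH]) (use AE_lborel_singleton[of 0] in eventually_elim, rule scale)
  also have "\<dots> = (LINT t|lborel. (LINT \<phi>|lborel. H t \<phi>))"
    by (rule lborel_pair.Fubini_integral[OF int_H])
  finally show ?thesis
    unfolding p_half_def g_def H_def two_sided_laplace_transform_abs(2)[OF abs_mean_pos] by simp
qed

lemma norm_resolvent_square_le:
  fixes k q :: real assumes "k > 0"
  shows "norm (1 / (of_real k - \<i> * of_real q)\<^sup>2) \<le> 1 / k\<^sup>2"
proof -
  have "k \<le> norm (of_real k - \<i> * of_real q)"
    using abs_Re_le_cmod[of "of_real k - \<i> * of_real q"] by simp
  then show ?thesis
    using assms by (simp add: norm_divide norm_power frac_le power_mono)
qed

lemma integrable_slope_resolvent:
  "integrable lborel (\<lambda>t. 1 / (of_real (abs_mean t) - \<i> * of_real (X * t + v))\<^sup>2)"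
proof (rule Bochner_Integration.integrable_bound[OF integrable_inverse_abs_mean_square])
  show "AE t in lborel. norm (1 / (of_real (abs_mean t) - \<i> * of_real (X * t + v))\<^sup>2)
      \<le> norm (1 / (abs_mean t)\<^sup>2)"
    by (rule AE_I2, rule order_trans[OF norm_resolvent_square_le[OF abs_mean_pos]]) simp
qed measurable

text \<open>
  Here \<open>k(t) = 1 + t/2\<close>, so the integrand is the inverse square of a function affine in \<open>t\<close>.
\<close>

lemma slope_integral_right:
  "(LBINT t=ereal (-1)..\<infinity>. 1 / (of_real (abs_mean t) - \<i> * of_real ((x + v / 2) * t + v))\<^sup>2)
     = 4 / ((1 - \<i> * of_real v)\<^sup>2 + 4 * (of_real x)\<^sup>2)"
proof -
  define w where "w = 1 / 2 - \<i> * of_real (x + v / 2)"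
  define b where "b = 1 - \<i> * of_real v"
  have w0: "w \<noteq> 0" by (simp add: w_def complex_eq_iff)
  let ?f = "\<lambda>t::real. 1 / (b + w * of_real t)\<^sup>2"
  let ?F = "\<lambda>t::real. - (inverse w * inverse (b + w * of_real t))"
  have nz: "b + w * of_real t \<noteq> 0" if "t \<ge> -1" for t :: real
  proof -
    have "Re (b + w * of_real t) > 0" using that by (simp add: b_def w_def)
    then show ?thesis by force
  qed
  have eq: "of_real (abs_mean t) - \<i> * of_real ((x + v / 2) * t + v) = b + w * of_real t" if "t \<ge> -1" for t
    using that by (simp add: abs_mean_right b_def w_def algebra_simps)
  have int: "set_integrable lborel {-1<..} ?f"
  proof (rule iffD1[OF set_integrable_cong])
    show "set_integrable lborel {-1<..} (\<lambda>t. 1 / (of_real (abs_mean t) - \<i> * of_real ((x + v / 2) * t + v))\<^sup>2)"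
      unfolding set_integrable_def
      by (rule integrable_mult_indicator[OF _ integrable_slope_resolvent]) simp
  qed (simp_all only: eq greaterThan_iff less_imp_le refl)
  have "filterlim (\<lambda>t. b + w * of_real t) at_infinity at_top"
    by (intro tendsto_add_filterlim_at_infinity[OF tendsto_const]
          tendsto_mult_filterlim_at_infinity[OF tendsto_const w0] filterlim_of_real_at_infinity)
  then have "((\<lambda>t. - (inverse w * inverse (b + w * of_real t))) \<longlongrightarrow> - (inverse w * 0)) at_top"
    by (intro tendsto_minus tendsto_mult tendsto_const filterlim_compose[OF tendsto_inverse_0])
  then have B: "((?F \<circ> real_of_ereal) \<longlongrightarrow> 0) (at_left \<infinity>)"
    unfolding ereal_tendsto_simps by simp
  have A: "((?F \<circ> real_of_ereal) \<longlongrightarrow> ?F (-1)) (at_right (ereal (-1)))"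
    unfolding ereal_tendsto_simps using nz[of "-1"] w0
    by (intro tendsto_intros) auto
  have D: "(?F has_vector_derivative ?f t) (at t)" if "t > -1" for t
  proof (rule has_vector_derivative_real_field)
    have n: "b + w * of_real t \<noteq> 0" using nz[of t] that by simp
    have "((\<lambda>z. b + w * z) has_field_derivative w) (at (of_real t))"
      by (rule derivative_eq_intros refl | simp)+
    from DERIV_minus[OF DERIV_cmult[OF DERIV_inverse_fun[OF this n]]]
    show "((\<lambda>z. - (inverse w * inverse (b + w * z))) has_field_derivative ?f t) (at (of_real t))"
      by (rule DERIV_cong) (use w0 in \<open>simp add: power2_eq_square divide_inverse\<close>)
  qed
  have C: "isCont ?f t" if "t > -1" for t
    using nz[of t] that by (intro continuous_intros) auto
  have "(LBINT t=ereal (-1)..\<infinity>. 1 / (of_real (abs_mean t) - \<i> * of_real ((x + v / 2) * t + v))\<^sup>2)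
      = (LBINT t=ereal (-1)..\<infinity>. ?f t)"
    by (rule interval_integral_cong) (simp add: eq einterval_iff del: of_real_add of_real_mult)
  also have "\<dots> = 0 - ?F (-1)"
    by (rule interval_integral_FTC_integrable[OF _ D C _ A B]) (use int in simp_all)
  also have "\<dots> = 4 / (4 * (w * (b - w)))" by (simp add: inverse_eq_divide)
  also have "4 * (w * (b - w)) = (1 - \<i> * of_real v)\<^sup>2 + 4 * (of_real x)\<^sup>2"
    by (simp add: w_def b_def algebra_simps power2_eq_square)
  finally show ?thesis .
qed

text \<open>
  With \<open>y = 1 + 2/t\<close> one has \<open>k(t) - \<i> q(t) = -(t/4) (1 + y\<^sup>2 + 4 \<i> x + 2 \<i> v y)\<close> and
  \<open>dy = -(2/t\<^sup>2) dt\<close>: the powers of \<open>t\<close> cancel and the factor \<open>8\<close> remains. As \<open>t\<close> goes from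
  \<open>-\<infinity>\<close> to \<open>-1\<close>, \<open>y\<close> decreases from \<open>1\<close> to \<open>-1\<close>.
\<close>

lemma slope_integral_left:
  fixes \<Phi> :: "real \<Rightarrow> complex"
  assumes \<Phi>: "\<And>y. (\<Phi> has_vector_derivative
     1 / (1 + (of_real y)\<^sup>2 + 4 * \<i> * of_real x + 2 * \<i> * of_real v * of_real y)\<^sup>2) (at y)"
  shows "(LBINT t=-\<infinity>..ereal (-1). 1 / (of_real (abs_mean t) - \<i> * of_real ((x + v / 2) * t + v))\<^sup>2)
     = 8 * (\<Phi> 1 - \<Phi> (- 1))"
proof -
  let ?f = "\<lambda>t. 1 / (of_real (abs_mean t) - \<i> * of_real ((x + v / 2) * t + v))\<^sup>2"
  let ?d = "\<lambda>y. 1 + (complex_of_real y)\<^sup>2 + 4 * \<i> * of_real x + 2 * \<i> * of_real v * of_real y"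
  let ?F = "\<lambda>t. - 8 * \<Phi> (1 + 2 / t)"
  have cont: "isCont \<Phi> y" for y
    using \<Phi>[of y] by (rule has_vector_derivative_continuous)
  have eq: "of_real (abs_mean t) - \<i> * of_real ((x + v / 2) * t + v)
      = (- of_real t / 4) * ?d (1 + 2 / t)" if "t < -1" for t
    using that by (simp add: abs_mean_left complex_eq_iff field_simps power2_eq_square)
  have nz: "of_real (abs_mean t) - \<i> * of_real ((x + v / 2) * t + v) \<noteq> 0" for t
    using abs_mean_pos[of t] by (auto simp: complex_eq_iff)
  have f_eq: "?f t = - 8 * (- (2 / t\<^sup>2) *\<^sub>R (1 / (?d (1 + 2 / t))\<^sup>2))" if "t < -1" for t
  proof -
    have "1 / (- of_real t / 4 * d)\<^sup>2 = - 8 * (- (2 / t\<^sup>2) *\<^sub>R (1 / d\<^sup>2))" for d :: complex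
      using that by (simp add: power_mult_distrib power_divide scaleR_conv_of_real)
    then show ?thesis unfolding eq[OF that] .
  qed
  have D: "(?F has_vector_derivative ?f t) (at t)" if "t < -1" for t
  proof -
    have "((\<lambda>t. 1 + 2 / t) has_real_derivative - (2 / t\<^sup>2)) (at t)"
      by (rule derivative_eq_intros refl | use that in \<open>simp add: power2_eq_square\<close>)+
    then have "((\<lambda>t. 1 + 2 / t) has_vector_derivative - (2 / t\<^sup>2)) (at t)"
      by (simp add: has_real_derivative_iff_has_vector_derivative)
    from vector_diff_chain_at[OF this \<Phi>]
    have "((\<lambda>t. \<Phi> (1 + 2 / t)) has_vector_derivative - (2 / t\<^sup>2) *\<^sub>R (1 / (?d (1 + 2 / t))\<^sup>2)) (at t)"
      by (simp add: o_def)
    then show ?thesis unfolding f_eq[OF that]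
      by (rule has_vector_derivative_mult_right)
  qed
  have C: "isCont ?f t" if "t < -1" for t
  proof -
    have "isCont abs_mean t"
    proof -
      have "isCont (\<lambda>t::real. (1 + (1 + t)\<^sup>2) / (- 2 * t)) t"
        using that by (intro continuous_intros) auto
      moreover have "\<forall>\<^sub>F s in nhds t. abs_mean s = (1 + (1 + s)\<^sup>2) / (- 2 * s)"
        using eventually_nhds_in_open[of "{..<-1}" t] that
        by (auto elim!: eventually_mono simp: abs_mean_left)
      ultimately show ?thesis by (simp add: isCont_cong)
    qed
    then show ?thesis using nz[of t] by (intro continuous_intros) auto
  qed
  have lim: "((\<lambda>t. 1 + 2 / t) \<longlongrightarrow> (1::real)) at_bot" by real_asymp
  have A: "((?F \<circ> real_of_ereal) \<longlongrightarrow> - 8 * \<Phi> 1) (at_right (-\<infinity>))"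
    unfolding ereal_tendsto_simps
    by (intro tendsto_mult tendsto_const isCont_tendsto_compose[OF cont lim])
  have lim': "((\<lambda>t. 1 + 2 / t) \<longlongrightarrow> 1 + 2 / (-1::real)) (at_left (-1))"
    by (intro tendsto_intros) auto
  have B: "((?F \<circ> real_of_ereal) \<longlongrightarrow> - 8 * \<Phi> (-1)) (at_left (ereal (-1)))"
    unfolding ereal_tendsto_simps
    using tendsto_mult[OF tendsto_const isCont_tendsto_compose[OF cont lim'], of "-8"] by simp
  have int: "set_integrable lborel (einterval (-\<infinity>) (ereal (-1))) ?f"
    unfolding set_integrable_def
    by (rule integrable_mult_indicator[OF _ integrable_slope_resolvent]) simp
  have "(LBINT t=-\<infinity>..ereal (-1). ?f t) = - 8 * \<Phi> (- 1) - (- 8 * \<Phi> 1)"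
    by (rule interval_integral_FTC_integrable[OF _ D C int A B]) auto
  then show ?thesis by (simp add: algebra_simps)
qed

text \<open>
  The two summands of the slope integral are complex conjugates of each other, so only twice the real
  part of one of them is needed.
\<close>

lemma p_half_antiderivative:
  fixes \<Phi> :: "real \<Rightarrow> complex"
  assumes "\<And>y. (\<Phi> has_vector_derivative
     1 / (1 + (of_real y)\<^sup>2 + 4 * \<i> * of_real x + 2 * \<i> * of_real v * of_real y)\<^sup>2) (at y)"
  shows "of_real (pi\<^sup>2 / 2) * p_half 1 (x + v / 2) v =
    of_real (Re (1 / ((1 - \<i> * of_real v)\<^sup>2 + 4 * (of_real x)\<^sup>2) + 2 * (\<Phi> 1 - \<Phi> (- 1))))"
proof -
  let ?f = "\<lambda>t. 1 / (of_real (abs_mean t) - \<i> * of_real ((x + v / 2) * t + v))\<^sup>2"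
  let ?J = "4 / ((1 - \<i> * of_real v)\<^sup>2 + 4 * (of_real x)\<^sup>2) + 8 * (\<Phi> 1 - \<Phi> (- 1))"
  note int = integrable_slope_resolvent[of "x + v / 2" v]
  have "(LBINT t=-\<infinity>..ereal (-1). ?f t) + (LBINT t=ereal (-1)..\<infinity>. ?f t) = (LBINT t=-\<infinity>..\<infinity>. ?f t)"
    by (rule interval_integral_sum)
       (use int in \<open>simp add: interval_lebesgue_integrable_def set_integrable_def\<close>)
  also have "\<dots> = (LINT t|lborel. ?f t)"
    by (simp add: interval_lebesgue_integral_def set_lebesgue_integral_def)
  finally have "?J = (LINT t|lborel. ?f t)"
    unfolding slope_integral_right slope_integral_left[OF assms] by (subst add.commute)
  then have J: "(LINT t|lborel. ?f t) = ?J" by (rule sym)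
  have c: "1 / (of_real (abs_mean t) + \<i> * of_real ((x + v / 2) * t + v))\<^sup>2 = cnj (?f t)" for t
    by simp
  have "(LINT t|lborel. ?f t + cnj (?f t)) = (LINT t|lborel. ?f t) + (LINT t|lborel. cnj (?f t))"
    by (rule Bochner_Integration.integral_add[OF int]) (use int in \<open>simp only: integrable_cnj\<close>)
  also have "\<dots> = ?J + cnj ?J"
    unfolding Bochner_Integration.integral_cnj J ..
  also have "\<dots> = of_real (2 * Re ?J)" by (rule complex_add_cnj)
  finally have "p_half 1 (x + v / 2) v = 1 / (2 * of_real pi)\<^sup>2 * of_real (2 * Re ?J)"
    unfolding p_half_slope_integral c by simp
  moreover define K where "K = 1 / ((1 - \<i> * of_real v)\<^sup>2 + 4 * (of_real x)\<^sup>2) + 2 * (\<Phi> 1 - \<Phi> (- 1))"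
  have "?J = of_real 4 * K"
    by (simp add: K_def algebra_simps)
  then have "Re ?J = 4 * Re K" by simp
  ultimately have "of_real (pi\<^sup>2 / 2) * p_half 1 (x + v / 2) v
      = of_real (pi\<^sup>2 / 2) * (1 / (2 * of_real pi)\<^sup>2 * of_real (2 * (4 * Re K)))"
    by (elim ssubst) (rule refl)
  also have "\<dots> = of_real (Re K)"
    by (simp add: power_mult_distrib field_simps)
  finally show ?thesis unfolding K_def .
qed

section \<open>The primitive of the inverse square of a quadratic\<close>

text \<open>
  A primitive of \<open>1 / (a + \<i> (y + s))\<close>, that is \<open>-\<i>\<close> times a complex logarithm of
  \<open>a + \<i> (y + s)\<close>. It is written by real functions so that no branch of the
  logarithm has to be followed, and so that its real and imaginary parts are explicit.
\<close>

definition log_primitive :: "real \<Rightarrow> real \<Rightarrow> real \<Rightarrow> complex" where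
  "log_primitive a s y = Complex (arctan ((y + s) / a)) (- ln (a\<^sup>2 + (y + s)\<^sup>2) / 2)"

lemma log_primitive_derivative:
  assumes "a > 0"
  shows "(log_primitive a s has_vector_derivative 1 / Complex a (y + s)) (at y)"
proof -
  have pos: "a\<^sup>2 + (y + s)\<^sup>2 > 0" using assms by (simp add: add_pos_nonneg)
  have lin: "((\<lambda>y. y + s) has_real_derivative 1) (at y)"
    by (rule derivative_eq_intros refl | simp)+
  have re: "((\<lambda>y. arctan ((y + s) / a)) has_real_derivative a / (a\<^sup>2 + (y + s)\<^sup>2)) (at y)"
  proof -
    from DERIV_chain2[OF DERIV_arctan DERIV_cdivide[OF lin, of a]]
    show ?thesis
      by (rule DERIV_cong) (use assms pos in \<open>simp add: field_simps power2_eq_square\<close>)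
  qed
  have half: "- (1 / m * (2 * n)) / 2 = - n / m" for m n :: real by simp
  have im: "((\<lambda>y. - ln (a\<^sup>2 + (y + s)\<^sup>2) / 2) has_real_derivative - (y + s) / (a\<^sup>2 + (y + s)\<^sup>2)) (at y)"
  proof -
    have "((\<lambda>y. a\<^sup>2 + (y + s)\<^sup>2) has_real_derivative 2 * (y + s)) (at y)"
      by (rule derivative_eq_intros refl | simp)+
    from DERIV_cdivide[OF DERIV_minus[OF DERIV_chain2[OF DERIV_ln_divide[OF pos] this]], of 2]
    show ?thesis
      by (rule DERIV_cong) (rule half)
  qed
  have scale: "((\<lambda>y. f y *\<^sub>R c) has_vector_derivative f' *\<^sub>R c) (at y)"
    if "(f has_real_derivative f') (at y)" for f f' and c :: complex
    using has_vector_derivative_scaleR[OF that has_vector_derivative_const[of c]] by simp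
  have "((\<lambda>y. arctan ((y + s) / a) *\<^sub>R (1::complex) + (- ln (a\<^sup>2 + (y + s)\<^sup>2) / 2) *\<^sub>R \<i>) has_vector_derivative
      (a / (a\<^sup>2 + (y + s)\<^sup>2)) *\<^sub>R 1 + (- (y + s) / (a\<^sup>2 + (y + s)\<^sup>2)) *\<^sub>R \<i>) (at y)"
    by (intro has_vector_derivative_add scale re im)
  moreover have "log_primitive a s = (\<lambda>y. arctan ((y + s) / a) *\<^sub>R (1::complex) + (- ln (a\<^sup>2 + (y + s)\<^sup>2) / 2) *\<^sub>R \<i>)"
    by (simp add: fun_eq_iff log_primitive_def complex_eq_iff)
  moreover have "(a / (a\<^sup>2 + (y + s)\<^sup>2)) *\<^sub>R 1 + (- (y + s) / (a\<^sup>2 + (y + s)\<^sup>2)) *\<^sub>R \<i> = 1 / Complex a (y + s)"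
    by (simp add: complex_eq_iff Re_divide Im_divide)
  ultimately show ?thesis by simp
qed

text \<open>
  With \<open>z = y + \<i> v\<close> and \<open>c = p + \<i> b\<close>, this is the usual partial fraction primitive of
  \<open>1 / (z\<^sup>2 + c\<^sup>2)\<^sup>2\<close>: the first summand removes the double poles, and the logarithmic terms come
  from the factors \<open>c + \<i> z = (p - v) + \<i> (y + b)\<close> and \<open>c - \<i> z = (p + v) - \<i> (y - b)\<close>.
\<close>

definition square_primitive :: "real \<Rightarrow> real \<Rightarrow> real \<Rightarrow> real \<Rightarrow> complex" where
  "square_primitive p b v y =
     Complex y v / (2 * (Complex p b)\<^sup>2 * ((Complex y v)\<^sup>2 + (Complex p b)\<^sup>2))
     + (log_primitive (p - v) b y + cnj (log_primitive (p + v) (- b) y)) / (4 * Complex p b ^ 3)"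

text \<open>
  With \<open>m = z\<^sup>2 + c\<^sup>2 = (c + \<i> z) (c - \<i> z)\<close> the derivative is
  \<open>(c\<^sup>2 - z\<^sup>2) / (2 c\<^sup>2 m\<^sup>2) + 1 / (2 c\<^sup>2 m)\<close>, which is \<open>1 / m\<^sup>2\<close>. The condition \<open>\<bar>v\<bar> < p\<close>
  gives both factors of \<open>m\<close> a positive real part for every real \<open>y\<close>.
\<close>

lemma square_primitive_derivative:
  assumes "\<bar>v\<bar> < p"
  shows "(square_primitive p b v has_vector_derivative 1 / ((Complex y v)\<^sup>2 + (Complex p b)\<^sup>2)\<^sup>2) (at y)"
proof -
  define c where "c = Complex p b"
  define z where "z = Complex y v"
  define m where "m = z\<^sup>2 + c\<^sup>2"
  have c: "c \<noteq> 0" using assms by (auto simp: c_def complex_eq_iff)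
  have plus: "Complex (p - v) (y + b) = c + \<i> * z" and minus: "cnj (Complex (p + v) (y + - b)) = c - \<i> * z"
    by (simp_all add: c_def z_def complex_eq_iff)
  have nz: "c + \<i> * z \<noteq> 0" "c - \<i> * z \<noteq> 0"
    unfolding plus[symmetric] minus[symmetric] using assms by (auto simp: complex_eq_iff)
  have m_fact: "m = (c + \<i> * z) * (c - \<i> * z)"
    by (simp add: m_def algebra_simps power2_eq_square)
  have m: "m \<noteq> 0" using nz by (simp add: m_fact)
  have rat: "((\<lambda>y. Complex y v / (2 * c\<^sup>2 * ((Complex y v)\<^sup>2 + c\<^sup>2))) has_vector_derivative
      (c\<^sup>2 - z\<^sup>2) / (2 * c\<^sup>2 * m\<^sup>2)) (at y)"
  proof -
    have z': "of_real y + \<i> * of_real v = z" by (simp add: z_def complex_eq_iff)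
    have lin: "((\<lambda>w. w + \<i> * of_real v) has_field_derivative 1) (at (of_real y))"
      by (rule derivative_eq_intros refl | simp)+
    have "((\<lambda>w. (w + \<i> * of_real v)\<^sup>2 + c\<^sup>2) has_field_derivative 2 * z) (at (of_real y))"
      by (rule derivative_eq_intros refl lin | simp add: z')+
    from DERIV_divide[OF lin DERIV_cmult[OF this, of "2 * c\<^sup>2"]]
    have "((\<lambda>w. (w + \<i> * of_real v) / (2 * c\<^sup>2 * ((w + \<i> * of_real v)\<^sup>2 + c\<^sup>2))) has_field_derivative
        (1 * (2 * c\<^sup>2 * m) - z * (2 * c\<^sup>2 * (2 * z))) / ((2 * c\<^sup>2 * m) * (2 * c\<^sup>2 * m))) (at (of_real y))"
      using c m by (simp add: z' m_def)
    moreover have "(1 * (2 * c\<^sup>2 * m) - z * (2 * c\<^sup>2 * (2 * z))) / ((2 * c\<^sup>2 * m) * (2 * c\<^sup>2 * m))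
        = (2 * c\<^sup>2 * (c\<^sup>2 - z\<^sup>2)) / ((2 * c\<^sup>2) * (2 * c\<^sup>2 * m\<^sup>2))"
      by (rule arg_cong2[where f = "(/)"]) (simp_all add: m_def algebra_simps power2_eq_square)
    moreover have "\<dots> = (c\<^sup>2 - z\<^sup>2) / (2 * c\<^sup>2 * m\<^sup>2)"
      using c by (intro mult_divide_mult_cancel_left) simp
    ultimately have "((\<lambda>w. (w + \<i> * of_real v) / (2 * c\<^sup>2 * ((w + \<i> * of_real v)\<^sup>2 + c\<^sup>2))) has_field_derivative
        (c\<^sup>2 - z\<^sup>2) / (2 * c\<^sup>2 * m\<^sup>2)) (at (of_real y))" by (simp only:)
    from has_vector_derivative_real_field[OF this]
    show ?thesis by (simp add: Complex_eq)
  qed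
  have log: "((\<lambda>y. (log_primitive (p - v) b y + cnj (log_primitive (p + v) (- b) y)) / (4 * c ^ 3)) has_vector_derivative
      (1 / (c + \<i> * z) + 1 / (c - \<i> * z)) / (4 * c ^ 3)) (at y)"
  proof -
    have a: "p - v > 0" "p + v > 0" using assms by auto
    have "((\<lambda>y. log_primitive (p - v) b y + cnj (log_primitive (p + v) (- b) y)) has_vector_derivative
        1 / Complex (p - v) (y + b) + cnj (1 / Complex (p + v) (y + - b))) (at y)"
      by (intro has_vector_derivative_add has_vector_derivative_cnj log_primitive_derivative a)
    then have "((\<lambda>y. log_primitive (p - v) b y + cnj (log_primitive (p + v) (- b) y)) has_vector_derivative
        1 / (c + \<i> * z) + 1 / (c - \<i> * z)) (at y)"
      unfolding complex_cnj_divide complex_cnj_one plus minus .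
    then show ?thesis by (rule has_vector_derivative_divide)
  qed
  have "1 / (c + \<i> * z) + 1 / (c - \<i> * z) = 2 * c / m"
    using nz unfolding m_fact by (simp add: add_frac_eq)
  then have "(1 / (c + \<i> * z) + 1 / (c - \<i> * z)) / (4 * c ^ 3) = 1 / (2 * c\<^sup>2 * m)"
    using c m by (simp add: power2_eq_square power3_eq_cube)
  moreover have "(c\<^sup>2 - z\<^sup>2) / (2 * c\<^sup>2 * m\<^sup>2) + 1 / (2 * c\<^sup>2 * m) = (c\<^sup>2 - z\<^sup>2 + m) / (2 * c\<^sup>2 * m\<^sup>2)"
    using c m by (simp add: add_divide_distrib power2_eq_square)
  moreover have "c\<^sup>2 - z\<^sup>2 + m = 2 * c\<^sup>2" by (simp add: m_def)
  ultimately have "(c\<^sup>2 - z\<^sup>2) / (2 * c\<^sup>2 * m\<^sup>2) + (1 / (c + \<i> * z) + 1 / (c - \<i> * z)) / (4 * c ^ 3) = 1 / m\<^sup>2"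
    using c by simp
  with has_vector_derivative_add[OF rat log] show ?thesis
    unfolding square_primitive_def[abs_def] c_def[symmetric] m_def z_def[symmetric] by simp
qed

section \<open>Real parts at the end points\<close>

text \<open>
  The first term is the contribution of the slopes \<open>t \<ge> -1\<close>, the other two are the boundary values of
  the rational summand of the primitive, with \<open>c\<^sup>2 = 1 + v\<^sup>2 + 4 \<i> x\<close>. All denominators factor through
  \<open>1 + \<i> (v + 2 x)\<close>, \<open>1 - \<i> (v - 2 x)\<close> and \<open>c\<^sup>2\<close>; the moduli of the first two cancel in the sum.
\<close>

lemma rational_part:
  "Re (1 / ((1 - \<i> * of_real v)\<^sup>2 + 4 * (of_real x)\<^sup>2)
      + Complex 1 v / (Complex (1 + v\<^sup>2) (4 * x) * ((Complex 1 v)\<^sup>2 + Complex (1 + v\<^sup>2) (4 * x)))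
      - Complex (- 1) v / (Complex (1 + v\<^sup>2) (4 * x) * ((Complex (- 1) v)\<^sup>2 + Complex (1 + v\<^sup>2) (4 * x))))
    = 2 / ((1 + v\<^sup>2)\<^sup>2 + 16 * x\<^sup>2)"
proof -
  define a where "a = v + 2 * x"
  define b where "b = v - 2 * x"
  define E where "E = (1 + v\<^sup>2)\<^sup>2 + 16 * x\<^sup>2"
  have E: "E > 0"
    unfolding E_def by (intro add_pos_nonneg zero_less_power) simp_all
  have a: "1 + a\<^sup>2 > 0" and b: "1 + b\<^sup>2 > 0"
    by (simp_all add: add_pos_nonneg)
  have 1: "Re (1 / ((1 - \<i> * of_real v)\<^sup>2 + 4 * (of_real x)\<^sup>2)) = (1 - a * b) / ((1 + a\<^sup>2) * (1 + b\<^sup>2))"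
  proof -
    have *: "(1 - \<i> * of_real v)\<^sup>2 + 4 * (of_real x)\<^sup>2 = Complex (1 - a * b) (- (a + b))"
      by (simp add: complex_eq_iff a_def b_def power2_eq_square algebra_simps)
    have "(1 - a * b)\<^sup>2 + (- (a + b))\<^sup>2 = (1 + a\<^sup>2) * (1 + b\<^sup>2)"
      by (simp add: power2_eq_square algebra_simps)
    then show ?thesis unfolding * Re_divide by simp
  qed
  have 2: "Re (Complex 1 v / (Complex (1 + v\<^sup>2) (4 * x) * ((Complex 1 v)\<^sup>2 + Complex (1 + v\<^sup>2) (4 * x))))
      = ((1 + v * a) * (1 + v\<^sup>2) - 8 * x\<^sup>2) / (2 * E * (1 + a\<^sup>2))"
  proof -
    have *: "(Complex 1 v)\<^sup>2 + Complex (1 + v\<^sup>2) (4 * x) = Complex 2 (2 * a)"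
      by (simp add: complex_eq_iff a_def power2_eq_square)
    have d: "(Re (Complex (1 + v\<^sup>2) (4 * x) * Complex 2 (2 * a)))\<^sup>2 + (Im (Complex (1 + v\<^sup>2) (4 * x) * Complex 2 (2 * a)))\<^sup>2
        = 2 * (2 * E * (1 + a\<^sup>2))"
      by (simp add: E_def power2_eq_square algebra_simps)
    have n: "Re (Complex 1 v) * Re (Complex (1 + v\<^sup>2) (4 * x) * Complex 2 (2 * a))
        + Im (Complex 1 v) * Im (Complex (1 + v\<^sup>2) (4 * x) * Complex 2 (2 * a))
        = 2 * ((1 + v * a) * (1 + v\<^sup>2) - 8 * x\<^sup>2)"
      by (simp add: a_def power2_eq_square algebra_simps)
    show ?thesis unfolding * Re_divide d n by (rule mult_divide_mult_cancel_left) simp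
  qed
  have 3: "Re (Complex (- 1) v / (Complex (1 + v\<^sup>2) (4 * x) * ((Complex (- 1) v)\<^sup>2 + Complex (1 + v\<^sup>2) (4 * x))))
      = - ((1 + v * b) * (1 + v\<^sup>2) - 8 * x\<^sup>2) / (2 * E * (1 + b\<^sup>2))"
  proof -
    have *: "(Complex (- 1) v)\<^sup>2 + Complex (1 + v\<^sup>2) (4 * x) = Complex 2 (- 2 * b)"
      by (simp add: complex_eq_iff b_def power2_eq_square)
    have d: "(Re (Complex (1 + v\<^sup>2) (4 * x) * Complex 2 (- 2 * b)))\<^sup>2 + (Im (Complex (1 + v\<^sup>2) (4 * x) * Complex 2 (- 2 * b)))\<^sup>2
        = 2 * (2 * E * (1 + b\<^sup>2))"
      by (simp add: E_def power2_eq_square algebra_simps)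
    have n: "Re (Complex (- 1) v) * Re (Complex (1 + v\<^sup>2) (4 * x) * Complex 2 (- 2 * b))
        + Im (Complex (- 1) v) * Im (Complex (1 + v\<^sup>2) (4 * x) * Complex 2 (- 2 * b))
        = 2 * (- ((1 + v * b) * (1 + v\<^sup>2) - 8 * x\<^sup>2))"
      by (simp add: b_def power2_eq_square algebra_simps)
    show ?thesis unfolding * Re_divide d n by (rule mult_divide_mult_cancel_left) simp
  qed
  have poly: "2 * E * (1 - a * b) + ((1 + v * a) * (1 + v\<^sup>2) - 8 * x\<^sup>2) * (1 + b\<^sup>2)
      + ((1 + v * b) * (1 + v\<^sup>2) - 8 * x\<^sup>2) * (1 + a\<^sup>2) = 4 * ((1 + a\<^sup>2) * (1 + b\<^sup>2))"
    unfolding E_def a_def b_def by (simp add: power2_eq_square algebra_simps)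
  have "(1 - a * b) / (A * B) + n1 / (2 * E * A) - - n2 / (2 * E * B) = 2 / E"
    if "2 * E * (1 - a * b) + n1 * B + n2 * A = 4 * (A * B)" "A > 0" "B > 0" for A B n1 n2
  proof -
    have "(1 - a * b) / (A * B) + n1 / (2 * E * A) - - n2 / (2 * E * B)
        = (2 * E * (1 - a * b) + n1 * B + n2 * A) / (2 * E * (A * B))"
      using that(2,3) E by (simp add: add_divide_distrib)
    also have "\<dots> = 2 / E" unfolding that(1) using that(2,3) E by simp
    finally show ?thesis .
  qed
  from this[OF poly a b] show ?thesis
    unfolding minus_complex.sel plus_complex.sel 1 2 3 E_def .
qed

text \<open>
  The arctangents are the real part of the logarithmic terms. Their imaginary part is half the
  logarithm of \<open>N(-b) / N(b)\<close>, where \<open>N(s) = ((p - v)\<^sup>2 + (1 + s)\<^sup>2) ((p + v)\<^sup>2 + (1 + s)\<^sup>2)\<close>;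
  under the constraint on \<open>v\<^sup>2\<close> this product collapses to \<open>4 (p\<^sup>2 (1 + s)\<^sup>2 + b\<^sup>2)\<close> for \<open>s = b\<close> and
  \<open>s = -b\<close>. Dividing by \<open>c\<^sup>3\<close>, with \<open>c = p + \<i> b\<close> and \<open>\<bar>c\<^sup>3\<bar>\<^sup>2 = R\<^sup>3\<close>, mixes the two parts with the
  real and imaginary parts of \<open>c\<^sup>3\<close> as coefficients.
\<close>

lemma square_primitive_increment:
  assumes "\<bar>v\<bar> < p" "p\<^sup>2 - b\<^sup>2 = 1 + v\<^sup>2" "p * b = 2 * x"
  defines "R \<equiv> p\<^sup>2 + b\<^sup>2"
  shows "Re ((log_primitive (p - v) b 1 + cnj (log_primitive (p + v) (- b) 1)
        - (log_primitive (p - v) b (- 1) + cnj (log_primitive (p + v) (- b) (- 1)))) / (2 * Complex p b ^ 3))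
    = (4 * x * p + (1 + v\<^sup>2) * b) / (4 * R ^ 3) * ln (1 - 8 * x * p / (4 * x * p + 4 * x\<^sup>2 + R))
      + ((1 + v\<^sup>2) * p - 4 * x * b) / (2 * R ^ 3)
        * (arctan ((1 - b) / (p + v)) + arctan ((1 + b) / (p + v))
           + arctan ((1 + b) / (p - v)) + arctan ((1 - b) / (p - v)))"
    (is "Re (?L / _) = _ * ln ?q + _ * ?T")
proof -
  have p: "p > 0" "p - v > 0" "p + v > 0" using assms(1) by auto
  define u where "u s = (p - v)\<^sup>2 + (1 + s)\<^sup>2" for s
  define w where "w s = (p + v)\<^sup>2 + (1 + s)\<^sup>2" for s
  have uw: "u s > 0" "w s > 0" for s
    unfolding u_def w_def using p by (simp_all add: add_pos_nonneg)
  have v2: "v\<^sup>2 = p\<^sup>2 - b\<^sup>2 - 1" using assms(2) by simp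
  have prod: "u s * w s = 4 * (p\<^sup>2 * (1 + s)\<^sup>2 + b\<^sup>2)" if "s\<^sup>2 = b\<^sup>2" for s
  proof -
    have "u s * w s = (p\<^sup>2 - v\<^sup>2)\<^sup>2 + (1 + s)\<^sup>2 * (2 * p\<^sup>2 + 2 * v\<^sup>2) + ((1 + s)\<^sup>2)\<^sup>2"
      by (simp add: u_def w_def power2_eq_square algebra_simps)
    also have "\<dots> = (1 + s\<^sup>2)\<^sup>2 + (1 + s)\<^sup>2 * (4 * p\<^sup>2 - 2 * s\<^sup>2 - 2) + ((1 + s)\<^sup>2)\<^sup>2"
      unfolding v2 that by (simp add: algebra_simps)
    also have "\<dots> = 4 * (p\<^sup>2 * (1 + s)\<^sup>2 + s\<^sup>2)"
      by (simp add: power2_eq_square algebra_simps)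
    finally show ?thesis using that by simp
  qed
  have x: "x = p * b / 2" using assms(3) by simp
  have num: "4 * x\<^sup>2 + R - 4 * x * p = p\<^sup>2 * (1 + - b)\<^sup>2 + b\<^sup>2"
    and den: "4 * x * p + 4 * x\<^sup>2 + R = p\<^sup>2 * (1 + b)\<^sup>2 + b\<^sup>2"
    unfolding x R_def by (simp_all add: power2_eq_square algebra_simps)
  have den_pos: "4 * x * p + 4 * x\<^sup>2 + R > 0"
    using mult_pos_pos[OF uw(1)[of b] uw(2)[of b]] unfolding prod[OF refl] den by simp
  have "?q = (4 * x\<^sup>2 + R - 4 * x * p) / (4 * x * p + 4 * x\<^sup>2 + R)"
    using den_pos by (simp add: divide_eq_eq eq_divide_eq left_diff_distrib)
  also have "\<dots> = (u (- b) * w (- b)) / (u b * w b)"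
    unfolding num den prod[OF refl] prod[OF power2_minus]
    by (rule mult_divide_mult_cancel_left[symmetric]) simp
  finally have ln_q: "ln ?q = ln (u (- b)) + ln (w (- b)) - ln (u b) - ln (w b)"
    using uw by (simp add: ln_div ln_mult less_imp_neq[symmetric])
  have re: "Re ?L = ?T"
  proof -
    have 1: "arctan ((- 1 + b) / (p - v)) = - arctan ((1 - b) / (p - v))"
      and 2: "arctan ((- 1 + - b) / (p + v)) = - arctan ((1 + b) / (p + v))"
      by (simp_all add: arctan_minus[symmetric] minus_divide_left del: arctan_minus)
    show ?thesis
      unfolding log_primitive_def minus_complex.sel plus_complex.sel complex_cnj complex.sel 1 2 by simp
  qed
  have im: "Im ?L = ln ?q / 2"
  proof -
    have 1: "(- 1 + b)\<^sup>2 = (1 + - b)\<^sup>2" and 2: "(- 1 + - b)\<^sup>2 = (1 + b)\<^sup>2"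
      by (simp_all add: power2_eq_square algebra_simps)
    show ?thesis
      unfolding ln_q log_primitive_def minus_complex.sel plus_complex.sel complex_cnj complex.sel 1 2
        u_def w_def by (simp add: field_simps)
  qed
  define \<alpha> where "\<alpha> = (1 + v\<^sup>2) * p - 4 * x * b"
  define \<beta> where "\<beta> = 4 * x * p + (1 + v\<^sup>2) * b"
  have cube: "Complex p b ^ 3 = Complex \<alpha> \<beta>"
    unfolding \<alpha>_def \<beta>_def assms(2)[symmetric] x
    by (simp add: complex_eq_iff power3_eq_cube power2_eq_square algebra_simps)
  have R3: "\<alpha>\<^sup>2 + \<beta>\<^sup>2 = R ^ 3"
    unfolding \<alpha>_def \<beta>_def assms(2)[symmetric] x R_def
    by (simp add: power3_eq_cube power2_eq_square algebra_simps)
  have "Re (?L / (2 * Complex p b ^ 3)) = Re (?L / Complex \<alpha> \<beta>) / 2"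
  proof -
    have "?L / (2 * Complex p b ^ 3) = ?L / Complex \<alpha> \<beta> / of_real 2"
      unfolding cube by simp
    then show ?thesis by (simp only: Re_divide_of_real)
  qed
  also have "\<dots> = (?T * \<alpha> + ln ?q / 2 * \<beta>) / R ^ 3 / 2"
    unfolding Re_divide re im complex.sel R3 ..
  also have "\<dots> = \<beta> / (4 * R ^ 3) * ln ?q + \<alpha> / (2 * R ^ 3) * ?T"
  proof -
    have "(t * a + l / 2 * c) / r / 2 = c / (4 * r) * l + a / (2 * r) * t" for t a l c r :: real
      by (cases "r = 0") (simp_all add: field_simps)
    then show ?thesis .
  qed
  finally show ?thesis unfolding \<alpha>_def \<beta>_def .
qed

section \<open>The closed form\<close>

text \<open>
  The hypotheses say that \<open>p + \<i> b\<close> is a square root of \<open>1 + v\<^sup>2 + 4 \<i> x\<close>, so \<open>b\<close> carries the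
  sign of \<open>x\<close>.
\<close>

lemma p_half_closed_form_signed:
  fixes p b v x :: real
  assumes "\<bar>v\<bar> < p" "p\<^sup>2 - b\<^sup>2 = 1 + v\<^sup>2" "p * b = 2 * x"
  defines "R \<equiv> p\<^sup>2 + b\<^sup>2"
  shows "of_real (pi\<^sup>2 / 2) * p_half 1 (x + v / 2) v = of_real
     (2 / ((1 + v\<^sup>2)\<^sup>2 + 16 * x\<^sup>2)
      + (4 * x * p + (1 + v\<^sup>2) * b) / (4 * R ^ 3) * ln (1 - 8 * x * p / (4 * x * p + 4 * x\<^sup>2 + R))
      + ((1 + v\<^sup>2) * p - 4 * x * b) / (2 * R ^ 3)
        * (arctan ((1 - b) / (p + v)) + arctan ((1 + b) / (p + v))
           + arctan ((1 + b) / (p - v)) + arctan ((1 - b) / (p - v))))"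
proof -
  have c2: "(Complex p b)\<^sup>2 = Complex (1 + v\<^sup>2) (4 * x)"
    using assms(2,3) by (simp add: complex_eq_iff power2_eq_square mult.commute)
  have den: "1 + (of_real y)\<^sup>2 + 4 * \<i> * of_real x + 2 * \<i> * of_real v * of_real y
      = (Complex y v)\<^sup>2 + (Complex p b)\<^sup>2" for y
    unfolding c2 by (simp add: complex_eq_iff power2_eq_square)
  let ?c = "Complex p b"
  let ?r = "\<lambda>y. Complex y v / (?c\<^sup>2 * ((Complex y v)\<^sup>2 + ?c\<^sup>2))"
  let ?l = "\<lambda>y. log_primitive (p - v) b y + cnj (log_primitive (p + v) (- b) y)"
  have combine: "2 * (r1 / 2 + l1 / (4 * k) - (r2 / 2 + l2 / (4 * k))) = r1 - r2 + (l1 - l2) / (2 * k)"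
    for r1 r2 l1 l2 k :: complex
    by (cases "k = 0") (simp_all add: field_simps)
  have reassoc: "m = r1 - r2 + l \<Longrightarrow> a + m = a + r1 - r2 + l" for a m r1 r2 l :: complex
    by simp
  have "square_primitive p b v y = ?r y / 2 + ?l y / (4 * ?c ^ 3)" for y
    by (simp add: square_primitive_def mult.assoc)
  then have "2 * (square_primitive p b v 1 - square_primitive p b v (- 1))
      = ?r 1 - ?r (- 1) + (?l 1 - ?l (- 1)) / (2 * ?c ^ 3)"
    by (simp only: combine)
  then have "1 / ((1 - \<i> * of_real v)\<^sup>2 + 4 * (of_real x)\<^sup>2)
        + 2 * (square_primitive p b v 1 - square_primitive p b v (- 1))
      = (1 / ((1 - \<i> * of_real v)\<^sup>2 + 4 * (of_real x)\<^sup>2) + ?r 1 - ?r (- 1)) + (?l 1 - ?l (- 1)) / (2 * ?c ^ 3)"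
    by (rule reassoc)
  then have "Re (1 / ((1 - \<i> * of_real v)\<^sup>2 + 4 * (of_real x)\<^sup>2)
        + 2 * (square_primitive p b v 1 - square_primitive p b v (- 1)))
      = Re (1 / ((1 - \<i> * of_real v)\<^sup>2 + 4 * (of_real x)\<^sup>2) + ?r 1 - ?r (- 1))
        + Re ((?l 1 - ?l (- 1)) / (2 * ?c ^ 3))"
    by (simp only: plus_complex.sel)
  then show ?thesis
    unfolding p_half_antiderivative[OF square_primitive_derivative[where b = b, OF assms(1), folded den]]
      square_primitive_increment[OF assms(1-3)] c2 rational_part R_def
    by (simp only: add.assoc)
qed

lemma ln_quotient_odd:
  fixes A B :: real assumes "A + B > 0" "A - B > 0"
  shows "ln (1 - 2 * - B / (- B + A)) = - ln (1 - 2 * B / (B + A))"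
proof -
  have "1 - 2 * - B / (- B + A) = (A + B) / (A - B)" "1 - 2 * B / (B + A) = (A - B) / (A + B)"
    using assms by (simp_all add: field_simps)
  then show ?thesis using assms by (simp add: ln_div)
qed

text \<open>
  The sum of arctangents is invariant under \<open>v \<mapsto> -v\<close> and \<open>b \<mapsto> -b\<close>. The logarithm is odd in
  \<open>x\<close>, and so is its coefficient when \<open>x\<close> and \<open>b\<close> change sign together. Hence for \<open>x < 0\<close> the
  signed formula at \<open>b = -q\<close> takes the same shape as for \<open>x \<ge> 0\<close>.
\<close>

lemma p_half_closed_form_unsigned:
  fixes p q v x :: real
  assumes "\<bar>v\<bar> < p" "p\<^sup>2 - q\<^sup>2 = 1 + v\<^sup>2" "p * q = 2 * \<bar>x\<bar>"
  defines "R \<equiv> p\<^sup>2 + q\<^sup>2"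
  shows "of_real (pi\<^sup>2 / 2) * p_half 1 (x + v / 2) v = of_real
     (2 / ((1 + v\<^sup>2)\<^sup>2 + 16 * x\<^sup>2)
      + (4 * \<bar>x\<bar> * p + (1 + v\<^sup>2) * q) / (4 * R ^ 3) * ln (1 - 8 * \<bar>x\<bar> * p / (4 * \<bar>x\<bar> * p + 4 * x\<^sup>2 + R))
      + ((1 + v\<^sup>2) * p - 4 * \<bar>x\<bar> * q) / (2 * R ^ 3)
        * (arctan ((1 - q) / (p + \<bar>v\<bar>)) + arctan ((1 + q) / (p + \<bar>v\<bar>))
           + arctan ((1 + q) / (p - \<bar>v\<bar>)) + arctan ((1 - q) / (p - \<bar>v\<bar>))))"
proof -
  define T where "T w s = arctan ((1 - s) / (p + w)) + arctan ((1 + s) / (p + w))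
           + arctan ((1 + s) / (p - w)) + arctan ((1 - s) / (p - w))" for w s :: real
  have T: "T (- w) s = T w s" "T w (- s) = T w s" for w s
    by (simp_all add: T_def)
  then have Tv: "T v s = T \<bar>v\<bar> s" for s by (simp add: abs_if)
  show ?thesis
  proof (cases "x \<ge> 0")
    case True
    then have "\<bar>x\<bar> = x" by simp
    with p_half_closed_form_signed[OF assms(1,2), of x] assms(3) show ?thesis
      unfolding R_def T_def[symmetric] Tv by simp
  next
    case False
    then have x: "\<bar>x\<bar> = - x" by simp
    have p: "p > 0" using assms(1) by auto
    have R: "R > 0" unfolding R_def using p by (simp add: add_pos_nonneg)
    have sum: "(4 * x\<^sup>2 + R) + 4 * \<bar>x\<bar> * p > 0"
      using R p by (intro add_pos_nonneg add_nonneg_pos) simp_all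
    have diff: "(4 * x\<^sup>2 + R) - 4 * \<bar>x\<bar> * p > 0"
    proof -
      have "4 * x\<^sup>2 = (p * q)\<^sup>2" unfolding assms(3) by (simp add: power_mult_distrib)
      then have "(4 * x\<^sup>2 + R) - 4 * \<bar>x\<bar> * p = (p * (1 - q))\<^sup>2 + q\<^sup>2"
        using assms(3) unfolding R_def by (simp add: power2_eq_square algebra_simps)
      moreover have "p * (1 - q) \<noteq> 0 \<or> q \<noteq> 0" using p by auto
      ultimately show ?thesis by (auto simp: sum_power2_gt_zero_iff)
    qed
    have "p * - q = 2 * x" using assms(3) x by simp
    note * = p_half_closed_form_signed[OF assms(1), of "- q" x, unfolded power2_minus, OF assms(2) this]
    have ln: "ln (1 - 8 * x * p / (4 * x * p + 4 * x\<^sup>2 + R)) = - ln (1 - 8 * \<bar>x\<bar> * p / (4 * \<bar>x\<bar> * p + 4 * x\<^sup>2 + R))"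
    proof -
      have "8 * x * p = 2 * - (4 * \<bar>x\<bar> * p)" "4 * x * p + 4 * x\<^sup>2 + R = - (4 * \<bar>x\<bar> * p) + (4 * x\<^sup>2 + R)"
        "8 * \<bar>x\<bar> * p = 2 * (4 * \<bar>x\<bar> * p)" "4 * \<bar>x\<bar> * p + 4 * x\<^sup>2 + R = 4 * \<bar>x\<bar> * p + (4 * x\<^sup>2 + R)"
        using x by simp_all
      then show ?thesis using ln_quotient_odd[OF sum diff] by (simp only:)
    qed
    have coef: "(4 * x * p + (1 + v\<^sup>2) * - q) / (4 * R ^ 3) = - ((4 * \<bar>x\<bar> * p + (1 + v\<^sup>2) * q) / (4 * R ^ 3))"
      unfolding x minus_divide_left by (simp add: algebra_simps)
    have coef': "4 * x * - q = 4 * \<bar>x\<bar> * q" using x by simp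
    show ?thesis
      using * unfolding R_def[symmetric] T_def[symmetric] T Tv ln coef coef' minus_mult_minus .
  qed
qed

text \<open>
  It remains to scale: \<open>p = P / sqrt 2\<close> and \<open>q = Q / sqrt 2\<close> satisfy the hypotheses of the unsigned form,
  because \<open>P Q = sqrt (R\<^sup>2 - (1 + v\<^sup>2)\<^sup>2) = 4 \<bar>x\<bar>\<close>.
\<close>

theorem theorem5p1:
  fixes x v E R P Q :: real
  assumes "E = (1 + v\<^sup>2)\<^sup>2 + 16 * x\<^sup>2"
    and "R = sqrt E"
    and "P = sqrt (R + 1 + v\<^sup>2)"
    and "Q = sqrt (R - 1 - v\<^sup>2)"
  shows "of_real (pi\<^sup>2 / 2) * p_half 1 (x + v / 2) v =
    complex_of_real
     (2 / E
      + (4 * \<bar>x\<bar> * P + (1 + v\<^sup>2) * Q) / (4 * sqrt 2 * R ^ 3)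
        * ln (1 - 4 * sqrt 2 * \<bar>x\<bar> / (2 * sqrt 2 * \<bar>x\<bar> + (4 * x\<^sup>2 + R) / P))
      + ((1 + v\<^sup>2) * P - 4 * \<bar>x\<bar> * Q) / (2 * sqrt 2 * R ^ 3)
        * (arctan ((sqrt 2 - Q) / (P + sqrt 2 * \<bar>v\<bar>))
           + arctan ((sqrt 2 + Q) / (P + sqrt 2 * \<bar>v\<bar>))
           + arctan ((sqrt 2 + Q) / (P - sqrt 2 * \<bar>v\<bar>))
           + arctan ((sqrt 2 - Q) / (P - sqrt 2 * \<bar>v\<bar>))))"
proof -
  define p where "p = P / sqrt 2"
  define q where "q = Q / sqrt 2"
  have P: "P = sqrt 2 * p" and Q: "Q = sqrt 2 * q" by (simp_all add: p_def q_def)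
  have E: "E \<ge> (1 + v\<^sup>2)\<^sup>2" using assms(1) by simp
  have RE: "R\<^sup>2 = E" unfolding assms(2) by (rule real_sqrt_pow2) (use E zero_le_power2[of "1 + v\<^sup>2"] in linarith)
  have R: "R \<ge> 1 + v\<^sup>2"
    unfolding assms(2) by (rule real_le_rsqrt[OF E])
  have v: "v\<^sup>2 \<ge> 0" by simp
  have P2: "P\<^sup>2 = R + 1 + v\<^sup>2" unfolding assms(3) by (rule real_sqrt_pow2) (use R v in linarith)
  have Q2: "Q\<^sup>2 = R - 1 - v\<^sup>2" unfolding assms(4) by (rule real_sqrt_pow2) (use R in linarith)
  have p2: "p\<^sup>2 = (R + 1 + v\<^sup>2) / 2" and q2: "q\<^sup>2 = (R - 1 - v\<^sup>2) / 2"
    unfolding p_def q_def power_divide P2 Q2 by simp_all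
  have nonneg: "P \<ge> 0" "Q \<ge> 0" 
    unfolding assms(3,4) by (rule real_sqrt_ge_zero, use R v in linarith)+
  have pq: "p * q = 2 * \<bar>x\<bar>"
  proof (rule power2_eq_imp_eq)
    have "(P * Q)\<^sup>2 = R\<^sup>2 - (1 + v\<^sup>2)\<^sup>2"
      unfolding power_mult_distrib P2 Q2 by (simp add: power2_eq_square algebra_simps)
    then have "(P * Q)\<^sup>2 = 16 * x\<^sup>2" unfolding RE assms(1) by simp
    then show "(p * q)\<^sup>2 = (2 * \<bar>x\<bar>)\<^sup>2"
      unfolding p_def q_def by (simp add: power_mult_distrib power_divide)
  qed (use nonneg in \<open>simp_all add: p_def q_def\<close>)
  have vp: "\<bar>v\<bar> < p"
  proof (rule power2_less_imp_less)
    show "\<bar>v\<bar>\<^sup>2 < p\<^sup>2" unfolding p2 power2_abs using R by simp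
  qed (use nonneg in \<open>simp add: p_def\<close>)
  then have p: "p > 0" by auto
  have pp: "p\<^sup>2 - q\<^sup>2 = 1 + v\<^sup>2" and R': "p\<^sup>2 + q\<^sup>2 = R" unfolding p2 q2 by (simp_all add: field_simps)
  have coef: "(4 * \<bar>x\<bar> * P + (1 + v\<^sup>2) * Q) / (4 * sqrt 2 * R ^ 3) = (4 * \<bar>x\<bar> * p + (1 + v\<^sup>2) * q) / (4 * R ^ 3)"
  proof -
    have "4 * \<bar>x\<bar> * P + (1 + v\<^sup>2) * Q = sqrt 2 * (4 * \<bar>x\<bar> * p + (1 + v\<^sup>2) * q)" "4 * sqrt 2 * R ^ 3 = sqrt 2 * (4 * R ^ 3)"
      unfolding P Q by (simp_all add: algebra_simps)
    then show ?thesis by (simp only: mult_divide_mult_cancel_left) simp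
  qed
  have coef': "((1 + v\<^sup>2) * P - 4 * \<bar>x\<bar> * Q) / (2 * sqrt 2 * R ^ 3) = ((1 + v\<^sup>2) * p - 4 * \<bar>x\<bar> * q) / (2 * R ^ 3)"
  proof -
    have "(1 + v\<^sup>2) * P - 4 * \<bar>x\<bar> * Q = sqrt 2 * ((1 + v\<^sup>2) * p - 4 * \<bar>x\<bar> * q)" "2 * sqrt 2 * R ^ 3 = sqrt 2 * (2 * R ^ 3)"
      unfolding P Q by (simp_all add: algebra_simps)
    then show ?thesis by (simp only: mult_divide_mult_cancel_left) simp
  qed
  have quot: "4 * sqrt 2 * \<bar>x\<bar> / (2 * sqrt 2 * \<bar>x\<bar> + (4 * x\<^sup>2 + R) / P) = 8 * \<bar>x\<bar> * p / (4 * \<bar>x\<bar> * p + 4 * x\<^sup>2 + R)"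
  proof -
    have P0: "P \<noteq> 0" using p by (simp add: P)
    have "4 * sqrt 2 * \<bar>x\<bar> / (2 * sqrt 2 * \<bar>x\<bar> + (4 * x\<^sup>2 + R) / P)
        = (P * (4 * sqrt 2 * \<bar>x\<bar>)) / (P * (2 * sqrt 2 * \<bar>x\<bar> + (4 * x\<^sup>2 + R) / P))"
      using P0 by (rule mult_divide_mult_cancel_left[symmetric])
    also have "P * (4 * sqrt 2 * \<bar>x\<bar>) = 8 * \<bar>x\<bar> * p" by (simp add: P)
    also have "P * (2 * sqrt 2 * \<bar>x\<bar> + (4 * x\<^sup>2 + R) / P) = P * (2 * sqrt 2 * \<bar>x\<bar>) + (4 * x\<^sup>2 + R)"
    proof -
      have "P * (c + d / P) = P * c + d" for c d :: real using P0 by (simp add: distrib_left)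
      then show ?thesis .
    qed
    also have "P * (2 * sqrt 2 * \<bar>x\<bar>) + (4 * x\<^sup>2 + R) = 4 * \<bar>x\<bar> * p + 4 * x\<^sup>2 + R" by (simp add: P)
    finally show ?thesis .
  qed
  have frac: "(sqrt 2 - Q) / (P + sqrt 2 * w) = (1 - q) / (p + w)" "(sqrt 2 + Q) / (P + sqrt 2 * w) = (1 + q) / (p + w)"
    "(sqrt 2 - Q) / (P - sqrt 2 * w) = (1 - q) / (p - w)" "(sqrt 2 + Q) / (P - sqrt 2 * w) = (1 + q) / (p - w)" for w
  proof -
    have "sqrt 2 - Q = sqrt 2 * (1 - q)" "sqrt 2 + Q = sqrt 2 * (1 + q)"
      "P + sqrt 2 * w = sqrt 2 * (p + w)" "P - sqrt 2 * w = sqrt 2 * (p - w)"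
      unfolding P Q by (simp_all add: algebra_simps)
    note e = this
    show "(sqrt 2 - Q) / (P + sqrt 2 * w) = (1 - q) / (p + w)" "(sqrt 2 + Q) / (P + sqrt 2 * w) = (1 + q) / (p + w)"
      "(sqrt 2 - Q) / (P - sqrt 2 * w) = (1 - q) / (p - w)" "(sqrt 2 + Q) / (P - sqrt 2 * w) = (1 + q) / (p - w)"
      unfolding e by (rule mult_divide_mult_cancel_left, simp)+
  qed
  show ?thesis
    using p_half_closed_form_unsigned[OF vp pp pq] unfolding R' coef coef' quot frac assms(1) .
qed

end
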